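(* Let $\mathcal I$ be a finite index set with $|\mathcal I|=n$, and for $i\in\mathcal I$ let $f(\mathbf w;i)=\frac12\|\mathbf A_i\mathbf w-\mathbf b_i\|^2$ with $\mathbf A_i\in\mathbb R^{n_i\times d}$, $\mathbf b_i\in\mathbb R^{n_i}$. Let $\beta>0$ satisfy $\|\mathbf A_i^\top\mathbf A_i\|\le\beta$ for all $i\in\mathcal I$, and assume there is $\mathbf w_\star\in\mathbb R^d$ with $f(\mathbf w_\star;i)=0$ for all $i\in\mathcal I$. Let $\pi=(\pi_0,\dots,\pi_{n-1})$ be a uniformly random permutation of $\mathcal I$, let $\mathbf w_0\in\mathbb R^d$, $0<\eta<2/\beta$, and $\mathbf w_{t+1}=\mathbf w_t-\eta\nabla f(\mathbf w_t;\pi_t)$. Put $\hat f_{0:T}(\mathbf w)=\frac1{T+1}\sum_{t=0}^Tf(\mathbf w;\pi_t)$ and $D=\|\mathbf w_0-\mathbf w_\star\|$. Then for all $T=2,\dots,n-1$, $$\mathbb E_\pi\hat f_{0:T}(\mathbf w_T)\le\frac{eD^2}{\eta(2-\eta\beta)\,T^{\,1-\eta\beta(1-\eta\beta/4)}}+\frac{4\beta^2\eta D^2}{T}.$$ In particular, $\eta=\frac1{\beta\log T}$ yields $\mathbb E_\pi\hat f_{0:T}(\mathbf w_T)\le\frac{14\beta D^2\log T}{T}$, and $\eta=\frac1\beta$ yields $\mathbb E_\pi\hat f_{0:T}(\mathbf w_T)\le\frac{7\beta D^2}{\sqrt[4]{T}}$.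
   Context: $\|\cdot\|$ is the Euclidean norm for vectors and the spectral norm for matrices; $\nabla f(\mathbf w;i)$ is the gradient in $\mathbf w$; $\log$ is the natural logarithm. *)

theory Defs
  imports
    "HOL-Probability.Probability"
    "HOL-Combinatorics.Multiset_Permutations"
begin

text \<open>
  A matrix with \<open>m\<close> rows and columns indexed by \<open>'d\<close> is given by \<open>m\<close> and its rows
  \<open>A 0, \<dots>, A (m - 1)\<close>, and a vector of length \<open>m\<close> by \<open>m\<close> and its entries; values at row
  numbers \<open>\<ge> m\<close> are ignored. This lets the number of rows vary within a family of matrices.
\<close>

definition lsq_loss :: "nat \<Rightarrow> (nat \<Rightarrow> real^'d) \<Rightarrow> (nat \<Rightarrow> real) \<Rightarrow> real^'d \<Rightarrow> real" where
  "lsq_loss m A b w = 1/2 * (L2_set (\<lambda>k. A k \<bullet> w - b k) {..<m})\<^sup>2"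

text \<open>The matrix \<open>A\<^sup>T A\<close>.\<close>

definition gram :: "nat \<Rightarrow> (nat \<Rightarrow> real^'d) \<Rightarrow> real^'d^'d" where
  "gram m A = (\<chi> p q. \<Sum>k<m. A k $ p * A k $ q)"

definition spectral_norm :: "real^'d^'d \<Rightarrow> real" where
  "spectral_norm M = onorm ((*v) M)"

definition grad :: "('a::real_inner \<Rightarrow> real) \<Rightarrow> 'a \<Rightarrow> 'a" where
  "grad f w = (THE D. GDERIV f w :> D)"

primrec sgd :: "('i \<Rightarrow> 'a::real_inner \<Rightarrow> real) \<Rightarrow> real \<Rightarrow> 'a \<Rightarrow> 'i list \<Rightarrow> nat \<Rightarrow> 'a" where
  "sgd f \<eta> w0 \<pi> 0 = w0"
| "sgd f \<eta> w0 \<pi> (Suc t) =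
     sgd f \<eta> w0 \<pi> t - \<eta> *\<^sub>R grad (f (\<pi> ! t)) (sgd f \<eta> w0 \<pi> t)"

definition avg_loss :: "('i \<Rightarrow> 'a \<Rightarrow> real) \<Rightarrow> 'i list \<Rightarrow> nat \<Rightarrow> 'a \<Rightarrow> real" where
  "avg_loss f \<pi> T w = (1 / real (T + 1)) * (\<Sum>t=0..T. f (\<pi> ! t) w)"

text \<open>
  \<open>permutations_of_set I\<close> consists of the lists that enumerate \<open>I\<close> without repetition.
\<close>

definition expected_last_loss ::
    "'i set \<Rightarrow> ('i \<Rightarrow> 'a::real_inner \<Rightarrow> real) \<Rightarrow> 'a \<Rightarrow> real \<Rightarrow> nat \<Rightarrow> real" where
  "expected_last_loss I f w0 \<eta> T =
     measure_pmf.expectation (pmf_of_set (permutations_of_set I))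
       (\<lambda>\<pi>. avg_loss f \<pi> T (sgd f \<eta> w0 \<pi> T))"

end

theory Submission
  imports Defs
begin

text \<open>
  Put \<open>x\<^sub>t = w\<^sub>t - w\<^sub>\<star>\<close>, \<open>\<kappa> = 1 - \<eta>\<beta>/2\<close> and \<open>g t = \<E> f(w\<^sub>t; \<pi>\<^sub>t)\<close>. By exchangeability
  \<open>g s = \<E> f(w\<^sub>s; \<pi>\<^sub>t)\<close> for all \<open>t \<ge> s\<close>. A gradient step on \<open>f(\<cdot>; i)\<close> satisfies
  \<open>\<parallel>w' - z\<parallel>\<^sup>2 \<le> \<parallel>w - z\<parallel>\<^sup>2 - 2\<eta>\<kappa> (f(w; i) - f(z; i) / \<kappa>\<^sup>2)\<close>; summing it with \<open>z = w\<^sub>s\<close> bounds the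
  tail sums of \<open>g\<close> by their first terms, which gives \<open>g T \<le> (2 / (T + 2))\<close> to the power \<open>\<kappa>\<^sup>2\<close>
  times \<open>\<Sum>g\<close>, and \<open>\<Sum>g \<le> D\<^sup>2 / (2\<eta>(2 - \<eta>\<beta>))\<close>. Exchanging \<open>\<pi>\<^sub>t\<close> and \<open>\<pi>\<^sub>T\<close> shows that
  \<open>\<E> f(w\<^sub>T; \<pi>\<^sub>t) \<le> 2 g T + 8\<beta>\<^sup>2\<eta>\<^sup>2 g t\<close>. Averaging over \<open>t\<close> leaves a factor \<open>1 / (2 - \<eta>\<beta>)\<close> too much
  in the second term when \<open>\<eta>\<beta> > 1\<close>. Then \<open>\<kappa>\<^sup>2 \<le> 1/4\<close>, and either \<open>T \<le> 256\<close> and the bound is weaker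
  than the trivial \<open>\<beta>D\<^sup>2/2\<close>, or the excess fits into the gap between 2 and \<open>e\<close> in the first term.
\<close>

section \<open>Gradient steps for positive semidefinite quadratics\<close>

text \<open>Together, \<open>nonneg\<close> and \<open>cocoercive\<close> place the spectrum of
  \<open>P\<close> between 0 and \<open>\<beta>\<close>, in the form that the step estimates
  consume.\<close>

locale psd_operator =
  fixes P :: "'a::real_inner \<Rightarrow> 'a" and \<beta> :: real
  assumes linear: "linear P"
    and self_adjoint: "P x \<bullet> y = x \<bullet> P y"
    and nonneg: "0 \<le> P x \<bullet> x"
    and cocoercive: "(norm (P x))\<^sup>2 \<le> \<beta> * (P x \<bullet> x)"
    and beta_pos: "0 < \<beta>"
begin

lemmas lin_simps = linear_add[OF linear] linear_diff[OF linear] linear_cmul[OF linear]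

text \<open>Cauchy-Schwarz and \<open>cocoercive\<close> bound the square of
  \<open>P x \<bullet> x\<close>, and one factor cancels.\<close>

lemma quadratic_le: "P x \<bullet> x \<le> \<beta> * (norm x)\<^sup>2"
proof -
  have "(P x \<bullet> x)\<^sup>2 \<le> (norm (P x))\<^sup>2 * (norm x)\<^sup>2"
    using Cauchy_Schwarz_ineq[of "P x" x] by (simp add: power2_norm_eq_inner)
  also have "\<dots> \<le> \<beta> * (P x \<bullet> x) * (norm x)\<^sup>2"
    by (intro mult_right_mono cocoercive) simp
  finally have "(P x \<bullet> x) * (P x \<bullet> x) \<le> (P x \<bullet> x) * (\<beta> * (norm x)\<^sup>2)"
    by (simp add: power2_eq_square algebra_simps)
  then show ?thesis
    using nonneg[of x] beta_pos by (cases "P x \<bullet> x = 0") (auto simp: mult_le_cancel_left)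
qed

text \<open>Parallelogram law for the seminorm of \<open>P\<close>: \<open>u\<close> is the sum of
  \<open>v\<close> and \<open>u - v\<close>, and \<open>2 *\<^sub>R v - u\<close> is their
  difference.\<close>

lemma quadratic_le_twice: "P u \<bullet> u \<le> 2 * (P v \<bullet> v) + 2 * (P (u - v) \<bullet> (u - v))"
proof -
  have "P (2 *\<^sub>R v - u) \<bullet> (2 *\<^sub>R v - u)
      = 2 * (P v \<bullet> v) + 2 * (P (u - v) \<bullet> (u - v)) - P u \<bullet> u"
    using self_adjoint[of u v] self_adjoint[of v u]
    by (simp add: lin_simps inner_diff_left inner_diff_right inner_commute algebra_simps)
  then show ?thesis
    using nonneg[of "2 *\<^sub>R v - u"] by simp
qed

text \<open>Young's inequality for the semi-inner product of \<open>P\<close>.\<close>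

lemma cross_term_le:
  assumes "0 < \<kappa>"
  shows "2 * (P x \<bullet> z) \<le> \<kappa> * (P x \<bullet> x) + (P z \<bullet> z) / \<kappa>"
proof -
  have "0 \<le> P (\<kappa> *\<^sub>R x - z) \<bullet> (\<kappa> *\<^sub>R x - z)"
    by (rule nonneg)
  also have "\<dots> = \<kappa>\<^sup>2 * (P x \<bullet> x) - 2 * \<kappa> * (P x \<bullet> z) + P z \<bullet> z"
    using self_adjoint[of x z] self_adjoint[of z x]
    by (simp add: lin_simps inner_diff_left inner_diff_right inner_commute power2_eq_square algebra_simps)
  finally show ?thesis
    using assms by (simp add: field_simps power2_eq_square)
qed

text \<open>Expand the square and split the cross term with weight \<open>\<kappa>\<close>. As
  \<open>\<eta> * \<beta> = 2 * (1 - \<kappa>)\<close>, the coefficients of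
  \<open>P x \<bullet> x\<close> add up to \<open>- \<eta> * \<kappa>\<close>.\<close>

lemma gradient_step:
  assumes "0 < \<eta>" "\<eta> * \<beta> < 2" and \<kappa>: "\<kappa> = 1 - \<eta> * \<beta> / 2"
  shows "(norm (x - \<eta> *\<^sub>R P x - z))\<^sup>2
    \<le> (norm (x - z))\<^sup>2 - 2 * \<eta> * \<kappa> * (P x \<bullet> x / 2 - P z \<bullet> z / 2 / \<kappa>\<^sup>2)"
proof -
  have \<kappa>0: "0 < \<kappa>" using assms by simp
  have "(norm (x - \<eta> *\<^sub>R P x - z))\<^sup>2
      = (norm (x - z))\<^sup>2 - 2 * \<eta> * (P x \<bullet> x) + \<eta> * (2 * (P x \<bullet> z)) + \<eta>\<^sup>2 * (norm (P x))\<^sup>2"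
    unfolding power2_norm_eq_inner
    by (simp add: inner_diff_left inner_diff_right inner_commute power2_eq_square algebra_simps)
  also have "\<dots> \<le> (norm (x - z))\<^sup>2 - 2 * \<eta> * (P x \<bullet> x)
      + \<eta> * (\<kappa> * (P x \<bullet> x) + (P z \<bullet> z) / \<kappa>) + \<eta>\<^sup>2 * (\<beta> * (P x \<bullet> x))"
    using assms(1) by (intro add_mono mult_left_mono cross_term_le cocoercive \<kappa>0) auto
  also have "\<dots> = (norm (x - z))\<^sup>2 - 2 * \<eta> * \<kappa> * (P x \<bullet> x / 2 - P z \<bullet> z / 2 / \<kappa>\<^sup>2)"
    using \<kappa>0 unfolding \<kappa> by (simp add: divide_simps) (simp add: power2_eq_square algebra_simps)
  finally show ?thesis .
qed

text \<open>For \<open>z = 0\<close> there is no cross term to split, so the decrease is twice that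
  of \<open>gradient_step\<close>.\<close>

lemma gradient_step_norm:
  assumes "0 < \<eta>" "\<eta> * \<beta> < 2"
  shows "(norm (x - \<eta> *\<^sub>R P x))\<^sup>2 \<le> (norm x)\<^sup>2 - 2 * \<eta> * (2 - \<eta> * \<beta>) * (P x \<bullet> x / 2)"
proof -
  have "(norm (x - \<eta> *\<^sub>R P x))\<^sup>2 = (norm x)\<^sup>2 - 2 * \<eta> * (P x \<bullet> x) + \<eta>\<^sup>2 * (norm (P x))\<^sup>2"
    unfolding power2_norm_eq_inner
    by (simp add: inner_diff_left inner_diff_right inner_commute power2_eq_square algebra_simps)
  also have "\<dots> \<le> (norm x)\<^sup>2 - 2 * \<eta> * (P x \<bullet> x) + \<eta>\<^sup>2 * (\<beta> * (P x \<bullet> x))"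
    by (intro add_mono mult_left_mono cocoercive) auto
  finally show ?thesis by (simp add: power2_eq_square algebra_simps)
qed

lemma gradient_step_nonexpansive:
  assumes "0 < \<eta>" "\<eta> * \<beta> < 2"
  shows "norm (x - \<eta> *\<^sub>R P x) \<le> norm x"
proof -
  have "0 \<le> 2 * \<eta> * (2 - \<eta> * \<beta>) * (P x \<bullet> x / 2)"
    using assms nonneg[of x] by simp
  then show ?thesis
    using gradient_step_norm[OF assms, of x] by (smt (verit) norm_ge_zero power2_le_imp_le)
qed

end

section \<open>Sequences with controlled tail sums\<close>

text \<open>
  If \<open>R s\<close> is the tail sum starting at \<open>s\<close>, the hypothesis says that its first term is at
  least \<open>q R s / (T - s + 1)\<close>; hence \<open>R (s + 1) \<le> (1 - q / (T - s + 1)) R s\<close>, and the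
  product of these factors telescopes.
\<close>
lemma last_term_le_tail_sum:
  fixes g :: "nat \<Rightarrow> real"
  assumes tail: "\<And>s. s \<le> T \<Longrightarrow> q * (\<Sum>t=s..T. g t) \<le> real (T - s + 1) * g s"
    and nonneg: "\<And>t. t \<le> T \<Longrightarrow> 0 \<le> g t"
    and "0 \<le> q" "j \<le> T"
  shows "g T \<le> (2 / (real j + 2)) powr q * (\<Sum>t=T-j..T. g t)"
  using \<open>j \<le> T\<close>
proof (induction j)
  \<comment> \<open>The factor \<open>2 / (real j + 2)\<close> is 1 here, and the tail consists of
    \<open>g T\<close> alone.\<close>
  case 0
  then show ?case by simp
next
  case (Suc j)
  define s k R where "s = T - Suc j" and "k = real j + 2" and "R = (\<Sum>t=s..T. g t)"
  have s: "s \<le> T" "T - j = Suc s" "real (T - s + 1) = k"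
    using Suc.prems by (auto simp: s_def k_def of_nat_diff)
  have k: "0 < k" by (simp add: k_def)
  have R: "0 \<le> R" unfolding R_def using nonneg by (intro sum_nonneg) auto
  have R_eq: "R = g s + (\<Sum>t=T-j..T. g t)"
    unfolding R_def s(2) using s(1) by (simp add: sum.atLeast_Suc_atMost)
  have "(\<Sum>t=T-j..T. g t) \<le> (1 - q / k) * R"
    using tail[OF s(1)] R_eq k unfolding s(3) R_def[symmetric] by (simp add: field_simps)
  also have "\<dots> \<le> (k / (k + 1)) powr q * R"
  proof (rule mult_right_mono[OF _ R])
    \<comment> \<open>Both sides are compared with \<open>exp (- (q / k))\<close>.\<close>
    have "ln (1 + 1 / k) \<le> 1 / k"
      using k by (intro ln_add_one_self_le_self) auto
    moreover have "ln (1 + 1 / k) = - ln (k / (k + 1))"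
      using k by (simp add: field_simps flip: ln_inverse)
    ultimately have "q * - ln (k / (k + 1)) \<le> q * (1 / k)"
      using \<open>0 \<le> q\<close> by (intro mult_left_mono) auto
    then have "exp (- (q / k)) \<le> (k / (k + 1)) powr q"
      using k by (simp add: powr_def)
    then show "1 - q / k \<le> (k / (k + 1)) powr q"
      using exp_ge_add_one_self[of "- (q / k)"] by linarith
  qed
  finally have "(\<Sum>t=T-j..T. g t) \<le> (k / (k + 1)) powr q * R" .
  then have "(2 / k) powr q * (\<Sum>t=T-j..T. g t) \<le> (2 / k) powr q * ((k / (k + 1)) powr q * R)"
    by (intro mult_left_mono) auto
  also have "\<dots> = (2 / (k + 1)) powr q * R"
    using k by (simp add: powr_mult[symmetric] mult.assoc[symmetric])
  finally show ?case
    using Suc by (simp add: k_def R_def s_def algebra_simps)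
qed

section \<open>Transpositions of permutations\<close>

text \<open>For \<open>s = t\<close> this is the identity, so exchange arguments need no case
  distinction.\<close>

definition swap_nth :: "nat \<Rightarrow> nat \<Rightarrow> 'b list \<Rightarrow> 'b list" where
  "swap_nth s t xs = xs[s := xs ! t, t := xs ! s]"

lemma nth_swap_nth:
  assumes "s < length xs" "t < length xs"
  shows "swap_nth s t xs ! k = (if k = s then xs ! t else if k = t then xs ! s else xs ! k)"
  using assms by (auto simp: swap_nth_def nth_list_update)

lemma swap_nth_mem_permutations_of_set:
  assumes "xs \<in> permutations_of_set S" "s < card S" "t < card S"
  shows "swap_nth s t xs \<in> permutations_of_set S"
proof -
  have "length xs = card S" using assms(1) by (rule length_finite_permutations_of_set)
  then show ?thesis
    using assms unfolding permutations_of_set_def swap_nth_def by simp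
qed

lemma swap_nth_involution:
  assumes "s < length xs" "t < length xs"
  shows "swap_nth s t (swap_nth s t xs) = xs"
  using assms by (intro nth_equalityI) (auto simp: nth_swap_nth swap_nth_def nth_list_update)

text \<open>The exchange is an involution of the set of permutations and so reindexes the
  sum.\<close>

lemma sum_permutations_swap_nth:
  assumes "s < card S" "t < card S"
  shows "(\<Sum>\<pi>\<in>permutations_of_set S. F (swap_nth s t \<pi>)) = (\<Sum>\<pi>\<in>permutations_of_set S. F \<pi>)"
  by (rule sum.reindex_bij_witness[where i = "swap_nth s t" and j = "swap_nth s t"])
    (use assms in \<open>auto simp: swap_nth_involution length_finite_permutations_of_set
      swap_nth_mem_permutations_of_set\<close>)

section \<open>Gradient descent along a random permutation\<close>

primrec descent :: "('i \<Rightarrow> 'a::real_vector \<Rightarrow> 'a) \<Rightarrow> real \<Rightarrow> 'a \<Rightarrow> 'i list \<Rightarrow> nat \<Rightarrow> 'a" where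
  "descent P \<eta> x0 \<pi> 0 = x0"
| "descent P \<eta> x0 \<pi> (Suc t) =
     descent P \<eta> x0 \<pi> t - \<eta> *\<^sub>R P (\<pi> ! t) (descent P \<eta> x0 \<pi> t)"

text \<open>Adaptedness of the iterates; it lets entries not yet visited be exchanged
  freely.\<close>

lemma descent_cong:
  "(\<And>s. s < t \<Longrightarrow> \<pi> ! s = \<pi>' ! s) \<Longrightarrow> descent P \<eta> x0 \<pi> t = descent P \<eta> x0 \<pi>' t"
  by (induction t) auto

text \<open>
  The point \<open>x\<close> stands for \<open>w - w\<^sub>\<star>\<close>, so that \<open>f(w; i) = \<phi> i x\<close> and
  \<open>\<nabla>f(w; i) = P i x\<close>.
\<close>
locale without_replacement_descent =
  fixes I :: "'i set" and P :: "'i \<Rightarrow> 'a::real_inner \<Rightarrow> 'a" and \<beta> \<eta> :: real and x0 :: 'a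
  assumes finite_I: "finite I"
    and psd: "i \<in> I \<Longrightarrow> psd_operator (P i) \<beta>"
    and beta_pos: "0 < \<beta>"
    and eta_pos: "0 < \<eta>"
    and eta_less: "\<eta> * \<beta> < 2"
begin

abbreviation "perms \<equiv> permutations_of_set I"

abbreviation "X \<equiv> descent P \<eta> x0"

definition \<phi> :: "'i \<Rightarrow> 'a \<Rightarrow> real" where
  "\<phi> i x = P i x \<bullet> x / 2"

text \<open>The expectation over a uniform permutation as a finite sum; it is identified with the
  expectation of the \<open>pmf\<close> only in the final theorem.\<close>

definition E :: "('i list \<Rightarrow> real) \<Rightarrow> real" where
  "E F = (\<Sum>\<pi>\<in>perms. F \<pi>) / real (card perms)"

definition g :: "nat \<Rightarrow> real" where
  "g s = E (\<lambda>\<pi>. \<phi> (\<pi> ! s) (X \<pi> s))"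

text \<open>Its square is the exponent
  \<open>1 - \<eta> * \<beta> * (1 - \<eta> * \<beta> / 4)\<close> of the final bound.\<close>

definition \<kappa> :: real where
  "\<kappa> = 1 - \<eta> * \<beta> / 2"

lemma kappa_pos: "0 < \<kappa>"
  using eta_less by (simp add: \<kappa>_def)

lemma E_mono: "(\<And>\<pi>. \<pi> \<in> perms \<Longrightarrow> F \<pi> \<le> G \<pi>) \<Longrightarrow> E F \<le> E G"
  unfolding E_def by (intro divide_right_mono sum_mono) auto

lemma E_const: "E (\<lambda>_. c) = c"
  using finite_I unfolding E_def by simp

lemma E_add: "E (\<lambda>\<pi>. F \<pi> + G \<pi>) = E F + E G"
  unfolding E_def by (simp add: sum.distrib add_divide_distrib)

lemma E_diff: "E (\<lambda>\<pi>. F \<pi> - G \<pi>) = E F - E G"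
  unfolding E_def by (simp add: sum_subtractf diff_divide_distrib)

lemma E_cmult: "E (\<lambda>\<pi>. c * F \<pi>) = c * E F"
  unfolding E_def by (simp add: sum_distrib_left)

lemma E_divide: "E (\<lambda>\<pi>. F \<pi> / c) = E F / c"
  unfolding E_def by (simp add: sum_divide_distrib[symmetric] mult.commute)

lemma E_sum: "E (\<lambda>\<pi>. \<Sum>t\<in>A. F t \<pi>) = (\<Sum>t\<in>A. E (F t))"
  unfolding E_def by (subst sum.swap) (simp add: sum_divide_distrib)

lemma E_swap:
  assumes "s < card I" "t < card I"
  shows "E (\<lambda>\<pi>. F (swap_nth s t \<pi>)) = E F"
  unfolding E_def sum_permutations_swap_nth[OF assms] ..

lemma nth_perm_mem:
  assumes "\<pi> \<in> perms" "t < card I"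
  shows "\<pi> ! t \<in> I"
  using assms length_finite_permutations_of_set[OF assms(1)] permutations_of_setD(1)[OF assms(1)]
  by (metis nth_mem)

lemma phi_nonneg: "i \<in> I \<Longrightarrow> 0 \<le> \<phi> i x"
  unfolding \<phi>_def using psd_operator.nonneg[OF psd] by simp

lemma norm_op_le: "i \<in> I \<Longrightarrow> (norm (P i x))\<^sup>2 \<le> 2 * \<beta> * \<phi> i x"
  unfolding \<phi>_def using psd_operator.cocoercive[OF psd] by simp

lemma g_nonneg: "s < card I \<Longrightarrow> 0 \<le> g s"
  unfolding g_def using E_mono[of "\<lambda>_. 0"] by (simp add: E_const nth_perm_mem phi_nonneg)

text \<open>Given the first \<open>s\<close> entries of \<open>\<pi>\<close>, every later entry has the same law.\<close>
lemma E_phi_later: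
  assumes "s \<le> t" "t < card I"
  shows "E (\<lambda>\<pi>. \<phi> (\<pi> ! t) (X \<pi> s)) = g s"
proof -
  have "E (\<lambda>\<pi>. \<phi> (\<pi> ! t) (X \<pi> s)) = E (\<lambda>\<pi>. \<phi> (swap_nth s t \<pi> ! s) (X (swap_nth s t \<pi>) s))"
    unfolding E_def
  proof (intro arg_cong2[where f = "(/)"] sum.cong refl)
    fix \<pi> assume \<pi>: "\<pi> \<in> perms"
    then have len: "length \<pi> = card I" by (rule length_finite_permutations_of_set)
    have "X (swap_nth s t \<pi>) s = X \<pi> s"
      using assms len by (intro descent_cong) (auto simp: nth_swap_nth)
    then show "\<phi> (\<pi> ! t) (X \<pi> s) = \<phi> (swap_nth s t \<pi> ! s) (X (swap_nth s t \<pi>) s)"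
      using assms len by (simp add: nth_swap_nth)
  qed
  also have "\<dots> = g s"
    unfolding g_def using assms by (intro E_swap) auto
  finally show ?thesis .
qed

lemma norm_iterate_le:
  assumes "\<pi> \<in> perms" "t \<le> card I"
  shows "norm (X \<pi> t) \<le> norm x0"
  using assms(2)
proof (induction t)
  case (Suc t)
  then have "norm (X \<pi> (Suc t)) \<le> norm (X \<pi> t)"
    using psd_operator.gradient_step_nonexpansive[OF psd[OF nth_perm_mem[OF assms(1)]] eta_pos eta_less]
    by simp
  with Suc show ?case by simp
qed simp

section \<open>Losses at the entry about to be visited\<close>

text \<open>Along each permutation \<open>gradient_step_norm\<close> telescopes, with
  \<open>2 * \<eta> * (2 - \<eta> * \<beta>) = 4 * \<eta> * \<kappa>\<close>.\<close>

lemma sum_g_le: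
  assumes "T < card I"
  shows "4 * \<eta> * \<kappa> * (\<Sum>t=0..T. g t) \<le> (norm x0)\<^sup>2"
proof -
  have "4 * \<eta> * \<kappa> * (\<Sum>t=0..T. \<phi> (\<pi> ! t) (X \<pi> t)) \<le> (norm x0)\<^sup>2" if \<pi>: "\<pi> \<in> perms" for \<pi>
  proof -
    have "4 * \<eta> * \<kappa> * (\<Sum>t=0..T. \<phi> (\<pi> ! t) (X \<pi> t))
        = (\<Sum>t=0..T. 2 * \<eta> * (2 - \<eta> * \<beta>) * \<phi> (\<pi> ! t) (X \<pi> t))"
      by (simp add: sum_distrib_left \<kappa>_def algebra_simps)
    also have "\<dots> \<le> (\<Sum>t=0..T. - (norm (X \<pi> (Suc t)))\<^sup>2 - - (norm (X \<pi> t))\<^sup>2)"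
    proof (rule sum_mono)
      fix t assume "t \<in> {0..T}"
      then have "\<pi> ! t \<in> I" using assms by (intro nth_perm_mem \<pi>) auto
      from psd_operator.gradient_step_norm[OF psd[OF this] eta_pos eta_less, of "X \<pi> t"]
      show "2 * \<eta> * (2 - \<eta> * \<beta>) * \<phi> (\<pi> ! t) (X \<pi> t)
          \<le> - (norm (X \<pi> (Suc t)))\<^sup>2 - - (norm (X \<pi> t))\<^sup>2"
        unfolding \<phi>_def by simp
    qed
    also have "\<dots> = - (norm (X \<pi> (Suc T)))\<^sup>2 - - (norm (X \<pi> 0))\<^sup>2"
      by (rule sum_Suc_diff) simp
    finally show ?thesis by (rule order_trans) simp
  qed
  then have "E (\<lambda>\<pi>. 4 * \<eta> * \<kappa> * (\<Sum>t=0..T. \<phi> (\<pi> ! t) (X \<pi> t))) \<le> E (\<lambda>_. (norm x0)\<^sup>2)"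
    by (rule E_mono)
  then show ?thesis
    unfolding E_cmult E_sum E_const g_def .
qed

text \<open>\<open>gradient_step\<close> with \<open>z = X \<pi> s\<close> telescopes from time
  \<open>s\<close>, where the distance to \<open>z\<close> is 0. By exchangeability each comparison
  loss at \<open>z\<close> averages to \<open>g s\<close>.\<close>

lemma tail_sum_g_le:
  assumes "s \<le> T" "T < card I"
  shows "\<kappa>\<^sup>2 * (\<Sum>t=s..T. g t) \<le> real (T - s + 1) * g s"
proof -
  let ?d = "\<lambda>\<pi> t. \<phi> (\<pi> ! t) (X \<pi> t) - \<phi> (\<pi> ! t) (X \<pi> s) / \<kappa>\<^sup>2"
  have "2 * \<eta> * \<kappa> * (\<Sum>t=s..T. ?d \<pi> t) \<le> 0" if \<pi>: "\<pi> \<in> perms" for \<pi>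
  proof -
    have "2 * \<eta> * \<kappa> * (\<Sum>t=s..T. ?d \<pi> t) = (\<Sum>t=s..T. 2 * \<eta> * \<kappa> * ?d \<pi> t)"
      by (rule sum_distrib_left)
    also have "\<dots> \<le> (\<Sum>t=s..T. - (norm (X \<pi> (Suc t) - X \<pi> s))\<^sup>2 - - (norm (X \<pi> t - X \<pi> s))\<^sup>2)"
    proof (rule sum_mono)
      fix t assume "t \<in> {s..T}"
      then have "\<pi> ! t \<in> I" using assms by (intro nth_perm_mem \<pi>) auto
      from psd_operator.gradient_step[OF psd[OF this] eta_pos eta_less \<kappa>_def, of "X \<pi> t" "X \<pi> s"]
      show "2 * \<eta> * \<kappa> * ?d \<pi> t
          \<le> - (norm (X \<pi> (Suc t) - X \<pi> s))\<^sup>2 - - (norm (X \<pi> t - X \<pi> s))\<^sup>2"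
        unfolding \<phi>_def by simp
    qed
    also have "\<dots> = - (norm (X \<pi> (Suc T) - X \<pi> s))\<^sup>2 - - (norm (X \<pi> s - X \<pi> s))\<^sup>2"
      using assms by (intro sum_Suc_diff) simp
    finally show ?thesis by (rule order_trans) simp
  qed
  then have "E (\<lambda>\<pi>. 2 * \<eta> * \<kappa> * (\<Sum>t=s..T. ?d \<pi> t)) \<le> E (\<lambda>_. 0)"
    by (rule E_mono)
  then have "2 * \<eta> * \<kappa> * (\<Sum>t=s..T. g t - E (\<lambda>\<pi>. \<phi> (\<pi> ! t) (X \<pi> s)) / \<kappa>\<^sup>2) \<le> 0"
    unfolding E_cmult E_sum E_const E_diff E_divide g_def .
  also have "(\<Sum>t=s..T. g t - E (\<lambda>\<pi>. \<phi> (\<pi> ! t) (X \<pi> s)) / \<kappa>\<^sup>2) = (\<Sum>t=s..T. g t - g s / \<kappa>\<^sup>2)"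
    using assms by (intro sum.cong refl) (simp add: E_phi_later)
  also have "\<dots> = (\<Sum>t=s..T. g t) - real (T - s + 1) * (g s / \<kappa>\<^sup>2)"
    using assms by (simp add: sum_subtractf Suc_diff_le)
  finally have "(\<Sum>t=s..T. g t) \<le> real (T - s + 1) * (g s / \<kappa>\<^sup>2)"
    using eta_pos kappa_pos by (simp add: mult_le_0_iff)
  then show ?thesis
    using kappa_pos by (simp add: field_simps)
qed

lemma g_last_le:
  assumes "T < card I"
  shows "4 * \<eta> * \<kappa> * g T \<le> (2 / (real T + 2)) powr \<kappa>\<^sup>2 * (norm x0)\<^sup>2"
proof -
  have "g T \<le> (2 / (real T + 2)) powr \<kappa>\<^sup>2 * (\<Sum>t=T-T..T. g t)"
    using assms by (intro last_term_le_tail_sum tail_sum_g_le g_nonneg) auto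
  then have "4 * \<eta> * \<kappa> * g T \<le> 4 * \<eta> * \<kappa> * ((2 / (real T + 2)) powr \<kappa>\<^sup>2 * (\<Sum>t=T-T..T. g t))"
    using eta_pos kappa_pos by (intro mult_left_mono) auto
  also have "\<dots> = (2 / (real T + 2)) powr \<kappa>\<^sup>2 * (4 * \<eta> * \<kappa> * (\<Sum>t=0..T. g t))"
    by simp
  also have "\<dots> \<le> (2 / (real T + 2)) powr \<kappa>\<^sup>2 * (norm x0)\<^sup>2"
    using assms by (intro mult_left_mono sum_g_le) auto
  finally show ?thesis .
qed

section \<open>Stability under an exchange\<close>

text \<open>Both runs coincide up to time \<open>t\<close>, where they take different steps from the
  same point. Afterwards they apply the same steps, and by linearity the difference itself undergoes
  a nonexpansive step.\<close>

lemma norm_diff_descent_le: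
  assumes "\<pi> \<in> perms" "\<pi>' \<in> perms" "t < T" "T \<le> card I"
    and eq: "\<And>s. s < T \<Longrightarrow> s \<noteq> t \<Longrightarrow> \<pi> ! s = \<pi>' ! s"
  shows "norm (X \<pi> T - X \<pi>' T) \<le> \<eta> * norm (P (\<pi> ! t) (X \<pi> t) - P (\<pi>' ! t) (X \<pi> t))"
  using assms(3,4) eq
proof (induction T)
  case 0
  then show ?case by simp
next
  case (Suc T)
  show ?case
  proof (cases "t = T")
    case True
    have "X \<pi>' T = X \<pi> T"
      using Suc.prems True by (intro descent_cong) auto
    then have "X \<pi> (Suc T) - X \<pi>' (Suc T) = - (\<eta> *\<^sub>R (P (\<pi> ! T) (X \<pi> T) - P (\<pi>' ! T) (X \<pi> T)))"
      by (simp add: algebra_simps)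
    then show ?thesis
      using eta_pos True by (simp del: descent.simps)
  next
    case False
    interpret psd_operator "P (\<pi> ! T)" \<beta>
      using assms(1) Suc.prems by (intro psd nth_perm_mem) auto
    have "\<pi>' ! T = \<pi> ! T" using Suc.prems False by simp
    then have "X \<pi> (Suc T) - X \<pi>' (Suc T) = (X \<pi> T - X \<pi>' T) - \<eta> *\<^sub>R P (\<pi> ! T) (X \<pi> T - X \<pi>' T)"
      by (simp add: lin_simps algebra_simps)
    then have "norm (X \<pi> (Suc T) - X \<pi>' (Suc T)) \<le> norm (X \<pi> T - X \<pi>' T)"
      using gradient_step_nonexpansive[OF eta_pos eta_less] by (simp del: descent.simps)
    also have "\<dots> \<le> \<eta> * norm (P (\<pi> ! t) (X \<pi> t) - P (\<pi>' ! t) (X \<pi> t))"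
      using Suc False by simp
    finally show ?thesis .
  qed
qed

text \<open>
  Exchanging \<open>\<pi> ! t\<close> and \<open>\<pi> ! T\<close> preserves the law of \<open>\<pi>\<close> and moves \<open>X \<pi> T\<close>
  only by the difference of two gradients at \<open>X \<pi> t\<close>.
\<close>
lemma E_phi_earlier_le:
  assumes "t < T" "T < card I"
  shows "E (\<lambda>\<pi>. \<phi> (\<pi> ! t) (X \<pi> T)) \<le> 2 * g T + 8 * \<beta>\<^sup>2 * \<eta>\<^sup>2 * g t"
proof -
  have "E (\<lambda>\<pi>. \<phi> (\<pi> ! t) (X \<pi> T)) = E (\<lambda>\<pi>. \<phi> (swap_nth t T \<pi> ! t) (X (swap_nth t T \<pi>) T))"
    using assms by (intro E_swap[symmetric]) auto
  also have "\<dots> \<le> E (\<lambda>\<pi>. 2 * \<phi> (\<pi> ! T) (X \<pi> T)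
      + 4 * \<beta>\<^sup>2 * \<eta>\<^sup>2 * (\<phi> (\<pi> ! t) (X \<pi> t) + \<phi> (\<pi> ! T) (X \<pi> t)))"
  proof (rule E_mono)
    fix \<pi> assume \<pi>: "\<pi> \<in> perms"
    define \<pi>' where "\<pi>' = swap_nth t T \<pi>"
    have \<pi>': "\<pi>' \<in> perms"
      unfolding \<pi>'_def using assms \<pi> by (intro swap_nth_mem_permutations_of_set) auto
    have len: "length \<pi> = card I" using \<pi> by (rule length_finite_permutations_of_set)
    have nth': "\<pi>' ! k = (if k = t then \<pi> ! T else if k = T then \<pi> ! t else \<pi> ! k)" for k
      unfolding \<pi>'_def using assms len by (simp add: nth_swap_nth)
    have mem: "\<pi> ! t \<in> I" "\<pi> ! T \<in> I"
      using assms by (auto intro!: nth_perm_mem \<pi>)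
    interpret psd_operator "P (\<pi> ! T)" \<beta> by (rule psd) (rule mem)
    let ?a = "P (\<pi> ! t) (X \<pi> t)" and ?b = "P (\<pi> ! T) (X \<pi> t)"
    have "norm (X \<pi>' T - X \<pi> T) \<le> \<eta> * norm (?a - ?b)"
      using norm_diff_descent_le[OF \<pi> \<pi>', of t T] assms by (simp add: nth' norm_minus_commute)
    then have "(norm (X \<pi>' T - X \<pi> T))\<^sup>2 \<le> \<eta>\<^sup>2 * (norm (?a - ?b))\<^sup>2"
      using power_mono[OF _ norm_ge_zero, of _ _ 2] by (fastforce simp: power_mult_distrib)
    also have "\<dots> \<le> \<eta>\<^sup>2 * (4 * \<beta> * (\<phi> (\<pi> ! t) (X \<pi> t) + \<phi> (\<pi> ! T) (X \<pi> t)))"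
    proof (rule mult_left_mono)
      \<comment> \<open>Parallelogram law with the term of \<open>?a + ?b\<close> dropped.\<close>
      have "(norm (?a - ?b))\<^sup>2 \<le> 2 * (norm ?a)\<^sup>2 + 2 * (norm ?b)\<^sup>2"
        using inner_ge_zero[of "?a + ?b"]
        by (simp add: power2_norm_eq_inner inner_simps inner_commute)
      also have "\<dots> \<le> 2 * (2 * \<beta> * \<phi> (\<pi> ! t) (X \<pi> t)) + 2 * (2 * \<beta> * \<phi> (\<pi> ! T) (X \<pi> t))"
        by (intro add_mono mult_left_mono norm_op_le mem) auto
      finally show "(norm (?a - ?b))\<^sup>2 \<le> 4 * \<beta> * (\<phi> (\<pi> ! t) (X \<pi> t) + \<phi> (\<pi> ! T) (X \<pi> t))"
        by (simp add: algebra_simps)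
    qed simp
    finally have diff: "(norm (X \<pi>' T - X \<pi> T))\<^sup>2
        \<le> \<eta>\<^sup>2 * (4 * \<beta> * (\<phi> (\<pi> ! t) (X \<pi> t) + \<phi> (\<pi> ! T) (X \<pi> t)))" .
    have "\<phi> (\<pi> ! T) (X \<pi>' T) \<le> 2 * \<phi> (\<pi> ! T) (X \<pi> T) + \<beta> * (norm (X \<pi>' T - X \<pi> T))\<^sup>2"
      unfolding \<phi>_def
      using quadratic_le_twice[of "X \<pi>' T" "X \<pi> T"] quadratic_le[of "X \<pi>' T - X \<pi> T"] by simp
    also have "\<dots> \<le> 2 * \<phi> (\<pi> ! T) (X \<pi> T)
        + \<beta> * (\<eta>\<^sup>2 * (4 * \<beta> * (\<phi> (\<pi> ! t) (X \<pi> t) + \<phi> (\<pi> ! T) (X \<pi> t))))"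
      using diff beta_pos by (intro add_left_mono mult_left_mono) auto
    also have "\<dots> = 2 * \<phi> (\<pi> ! T) (X \<pi> T)
        + 4 * \<beta>\<^sup>2 * \<eta>\<^sup>2 * (\<phi> (\<pi> ! t) (X \<pi> t) + \<phi> (\<pi> ! T) (X \<pi> t))"
      by (simp add: power2_eq_square)
    finally show "\<phi> (swap_nth t T \<pi> ! t) (X (swap_nth t T \<pi>) T) \<le> \<dots>"
      by (simp add: nth' flip: \<pi>'_def)
  qed
  also have "\<dots> = 2 * g T + 4 * \<beta>\<^sup>2 * \<eta>\<^sup>2 * (g t + E (\<lambda>\<pi>. \<phi> (\<pi> ! T) (X \<pi> t)))"
    unfolding E_add E_cmult g_def ..
  \<comment> \<open>Entry \<open>T\<close> is unvisited at time \<open>t\<close>, so both losses at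
    \<open>X \<pi> t\<close> average to \<open>g t\<close>.\<close>
  also have "\<dots> = 2 * g T + 8 * \<beta>\<^sup>2 * \<eta>\<^sup>2 * g t"
    using assms by (simp add: E_phi_later)
  finally show ?thesis .
qed

section \<open>Bounds for the average loss of the last iterate\<close>

definition last_loss :: "nat \<Rightarrow> real" where
  "last_loss T = E (\<lambda>\<pi>. 1 / real (T + 1) * (\<Sum>t=0..T. \<phi> (\<pi> ! t) (X \<pi> T)))"

lemma last_loss_eq: "last_loss T = 1 / real (T + 1) * (\<Sum>t=0..T. E (\<lambda>\<pi>. \<phi> (\<pi> ! t) (X \<pi> T)))"
  unfolding last_loss_def E_cmult E_sum ..

lemma last_loss_le:
  assumes "T < card I"
  shows "last_loss T \<le> 2 * g T + 8 * \<beta>\<^sup>2 * \<eta>\<^sup>2 / real (T + 1) * (\<Sum>t=0..T. g t)"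
proof -
  have "(\<Sum>t=0..T. E (\<lambda>\<pi>. \<phi> (\<pi> ! t) (X \<pi> T))) \<le> (\<Sum>t=0..T. 2 * g T + 8 * \<beta>\<^sup>2 * \<eta>\<^sup>2 * g t)"
  proof (rule sum_mono)
    fix t assume t: "t \<in> {0..T}"
    show "E (\<lambda>\<pi>. \<phi> (\<pi> ! t) (X \<pi> T)) \<le> 2 * g T + 8 * \<beta>\<^sup>2 * \<eta>\<^sup>2 * g t"
    proof (cases "t = T")
      case True
      then show ?thesis
        using g_nonneg[OF assms] by (simp add: E_phi_later assms)
    next
      case False
      then show ?thesis using t assms by (intro E_phi_earlier_le) auto
    qed
  qed
  also have "\<dots> = real (T + 1) * (2 * g T) + 8 * \<beta>\<^sup>2 * \<eta>\<^sup>2 * (\<Sum>t=0..T. g t)"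
    by (simp add: sum.distrib sum_distrib_left)
  finally have "last_loss T
      \<le> 1 / real (T + 1) * (real (T + 1) * (2 * g T) + 8 * \<beta>\<^sup>2 * \<eta>\<^sup>2 * (\<Sum>t=0..T. g t))"
    unfolding last_loss_eq by (intro mult_left_mono) auto
  then show ?thesis
    by (simp add: distrib_left)
qed

text \<open>Trivial bound: no step increases the distance to the common minimizer.\<close>

lemma last_loss_le_half:
  assumes "T < card I"
  shows "last_loss T \<le> \<beta> * (norm x0)\<^sup>2 / 2"
proof -
  have "E (\<lambda>\<pi>. \<phi> (\<pi> ! t) (X \<pi> T)) \<le> E (\<lambda>_. \<beta> * (norm x0)\<^sup>2 / 2)" if "t \<in> {0..T}" for t
  proof (rule E_mono)
    fix \<pi> assume \<pi>: "\<pi> \<in> perms"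
    have "\<pi> ! t \<in> I" using that assms by (intro nth_perm_mem \<pi>) auto
    from psd_operator.quadratic_le[OF psd[OF this], of "X \<pi> T"]
    have "\<phi> (\<pi> ! t) (X \<pi> T) \<le> \<beta> * (norm (X \<pi> T))\<^sup>2 / 2" by (simp add: \<phi>_def)
    also have "\<dots> \<le> \<beta> * (norm x0)\<^sup>2 / 2"
      using beta_pos assms
      by (intro divide_right_mono mult_left_mono power_mono norm_iterate_le \<pi>) auto
    finally show "\<phi> (\<pi> ! t) (X \<pi> T) \<le> \<beta> * (norm x0)\<^sup>2 / 2" .
  qed
  then have "(\<Sum>t=0..T. E (\<lambda>\<pi>. \<phi> (\<pi> ! t) (X \<pi> T))) \<le> (\<Sum>t=0..T. \<beta> * (norm x0)\<^sup>2 / 2)"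
    unfolding E_const by (rule sum_mono)
  then show ?thesis
    unfolding last_loss_eq by (simp add: field_simps)
qed

lemma last_loss_bound:
  assumes "T < card I" "1 \<le> T"
  shows "last_loss T
    \<le> exp 1 * (norm x0)\<^sup>2 / (\<eta> * (2 - \<eta> * \<beta>) * real T powr (1 - \<eta> * \<beta> * (1 - \<eta> * \<beta> / 4)))
      + 4 * \<beta>\<^sup>2 * \<eta> * (norm x0)\<^sup>2 / real T"
proof -
  \<comment> \<open>In these terms the claimed bound is
    \<open>exp 1 * (c * u) + 4 * y\<^sup>2 * c * (2 - y) / real T\<close>.\<close>
  define y q u c where "y = \<eta> * \<beta>" and "q = \<kappa>\<^sup>2" and "u = 1 / real T powr q"
    and "c = (norm x0)\<^sup>2 / (\<eta> * (2 - y))"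
  have T: "1 \<le> real T" using assms by simp
  have y: "0 < y" "y < 2" using eta_pos beta_pos eta_less by (auto simp: y_def)
  have c: "0 \<le> c" using y eta_pos by (simp add: c_def)
  have u: "0 < u" using T by (simp add: u_def)
  have q: "q = 1 - y * (1 - y / 4)"
    by (simp add: q_def \<kappa>_def y_def power2_eq_square algebra_simps)
  have \<kappa>: "0 < \<kappa>" "\<kappa> \<le> 1"
    using kappa_pos y(1) by (auto simp: \<kappa>_def y_def)
  then have q01: "0 \<le> q" "q \<le> 1"
    by (auto simp: q_def power_le_one)
  have \<kappa>y: "4 * \<eta> * \<kappa> = 2 * (\<eta> * (2 - y))"
    by (simp add: \<kappa>_def y_def algebra_simps)
  have pos: "0 < \<eta> * (2 - y)" using eta_pos y by simp
  \<comment> \<open>The constant 9/4 serves both regimes of \<open>T\<close> below: 9/16 exceeds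
    1/2, and \<open>exp 1 - 2\<close> is at least 1/4.\<close>
  have e: "9 / 4 \<le> exp (1::real)"
  proof -
    have "(1 + 1 / 2)\<^sup>2 \<le> (exp (1 / 2 :: real))\<^sup>2"
      by (intro power_mono exp_ge_add_one_self) auto
    then show ?thesis by (simp add: power2_eq_square flip: exp_add)
  qed

  have "(2 / (real T + 2)) powr q \<le> (2 / real T) powr q"
    using T q01 by (intro powr_mono2) (auto simp: frac_le)
  also have "\<dots> = 2 powr q * u"
    using T by (simp add: powr_divide u_def)
  also have "\<dots> \<le> 2 * u"
    using u q01 powr_mono[of q 1 "2::real"] by (intro mult_right_mono) auto
  finally have "(2 / (real T + 2)) powr q * (norm x0)\<^sup>2 \<le> 2 * u * (norm x0)\<^sup>2"
    by (intro mult_right_mono) auto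
  with g_last_le[OF assms(1)] have "\<eta> * (2 - y) * (2 * g T) \<le> 2 * u * (norm x0)\<^sup>2"
    unfolding \<kappa>y q_def by simp
  then have 1: "2 * g T \<le> 2 * (c * u)"
    using pos by (simp add: c_def pos_le_divide_eq mult.commute mult.left_commute)

  have "2 * (\<eta> * (2 - y)) * (\<Sum>t=0..T. g t) \<le> (norm x0)\<^sup>2"
    using sum_g_le[OF assms(1)] unfolding \<kappa>y .
  then have "2 * (\<Sum>t=0..T. g t) \<le> c"
    unfolding c_def pos_le_divide_eq[OF pos] by (simp only: mult_ac)
  then have "4 * y\<^sup>2 / real (T + 1) * (2 * (\<Sum>t=0..T. g t)) \<le> 4 * y\<^sup>2 / real T * c"
    using T c by (intro mult_mono divide_left_mono sum_nonneg mult_nonneg_nonneg g_nonneg)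
      (use assms in auto)
  moreover have "8 * \<beta>\<^sup>2 * \<eta>\<^sup>2 / real (T + 1) * (\<Sum>t=0..T. g t)
      = 4 * y\<^sup>2 / real (T + 1) * (2 * (\<Sum>t=0..T. g t))"
    by (simp add: y_def power_mult_distrib)
  moreover have "4 * y\<^sup>2 / real T * c = 4 * y\<^sup>2 * c / real T" by simp
  ultimately have "last_loss T \<le> 2 * (c * u) + 4 * y\<^sup>2 * c / real T"
    using last_loss_le[OF assms(1)] 1 by linarith
  moreover have "last_loss T \<le> y * (2 - y) * c / 2"
    using last_loss_le_half[OF assms(1)] y eta_pos by (simp add: c_def y_def)
  \<comment> \<open>One of the two upper bounds just obtained always lies below the target.\<close>
  moreover have "2 * (c * u) + 4 * y\<^sup>2 * c / real T \<le> exp 1 * (c * u) + 4 * y\<^sup>2 * c * (2 - y) / real T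
    \<or> y * (2 - y) * c / 2 \<le> exp 1 * (c * u) + 4 * y\<^sup>2 * c * (2 - y) / real T"
  proof (cases "y \<le> 1")
    case True
    have "4 * y\<^sup>2 * c * 1 \<le> 4 * y\<^sup>2 * c * (2 - y)"
      using True c by (intro mult_left_mono) auto
    then have "4 * y\<^sup>2 * c / real T \<le> 4 * y\<^sup>2 * c * (2 - y) / real T"
      by (intro divide_right_mono) auto
    moreover have "2 * (c * u) \<le> exp 1 * (c * u)"
      using c u e by (intro mult_right_mono) auto
    ultimately show ?thesis by simp
  next
    case False
    have "\<kappa> \<le> 1 / 2" using False by (simp add: \<kappa>_def y_def)
    then have "\<kappa>\<^sup>2 \<le> (1 / 2)\<^sup>2" using \<kappa> by (intro power_mono) auto
    then have Tq: "real T powr q \<le> real T powr (1 / 4)"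
      using T by (intro powr_mono) (auto simp: q_def power2_eq_square)
    have four: "256 powr (1 / 4) = (4::real)"
      using powr_powr[of "4::real" 4 "1 / 4"] by (simp add: powr_numeral)
    show ?thesis
    proof (cases "real T \<le> 256")
      case True
      \<comment> \<open>Here \<open>u \<ge> 1 / 4\<close>, so the first target term is at least
        \<open>9 / 16 * c\<close>, while the trivial bound is at most \<open>c / 2\<close>.\<close>
      have "real T powr (1 / 4) \<le> 4"
        using powr_mono2[of "1 / 4" "real T" 256] True T four by simp
      then have "1 / 4 \<le> u"
        using Tq T by (simp add: u_def field_simps)
      then have "9 / 4 * (1 / 4) \<le> exp 1 * u"
        using e by (intro mult_mono) auto
      then have "c * (1 / 2) \<le> c * (exp 1 * u)"
        using c by (intro mult_left_mono) auto
      moreover have "c * (exp 1 * u) = exp 1 * (c * u)" by simp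
      moreover have "y * (2 - y) \<le> 1"
        using zero_le_square[of "y - 1"] by (simp add: algebra_simps)
      then have "y * (2 - y) * c \<le> 1 * c"
        using c by (intro mult_right_mono) auto
      moreover have "0 \<le> 4 * y\<^sup>2 * c * (2 - y) / real T"
        using c y by simp
      ultimately have "y * (2 - y) * c / 2 \<le> exp 1 * (c * u) + 4 * y\<^sup>2 * c * (2 - y) / real T"
        by linarith
      then show ?thesis ..
    next
      case False
      \<comment> \<open>With fourth root at least 4 and \<open>q \<le> 1 / 4\<close>,
        \<open>real T\<close> is at least 64 times \<open>real T powr q\<close>. The excess of the
        second term, at most \<open>16 * c / real T\<close>, then fits into
        \<open>(exp 1 - 2) * u * c\<close>.\<close>
      have "real T = real T powr (1 / 4) * (real T powr (1 / 4))^3"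
        using T by (simp add: power3_eq_cube flip: powr_add)
      moreover have "4 \<le> real T powr (1 / 4)"
        using powr_mono2[of "1 / 4" 256 "real T"] False four by simp
      then have "4^3 \<le> (real T powr (1 / 4))^3"
        by (rule power_mono) simp
      then have "real T powr q * 4^3 \<le> real T powr (1 / 4) * (real T powr (1 / 4))^3"
        using Tq by (intro mult_mono) auto
      ultimately have "real T powr q * 64 \<le> real T" by simp
      then have uT: "16 / real T \<le> u / 4"
        using T by (simp add: u_def field_simps)
      have "y\<^sup>2 * (y - 1) \<le> 2\<^sup>2 * 1"
        using y \<open>\<not> y \<le> 1\<close> by (intro mult_mono power_mono) auto
      then have "4 * y\<^sup>2 * (y - 1) / real T \<le> 16 / real T"
        by (intro divide_right_mono) (auto simp: mult.commute)
      also note uT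
      also have "u / 4 \<le> (exp 1 - 2) * u"
        using e u by (simp add: mult_right_mono)
      finally have "4 * y\<^sup>2 * (y - 1) / real T * c \<le> (exp 1 - 2) * u * c"
        using c by (rule mult_right_mono)
      moreover have "4 * y\<^sup>2 * (y - 1) / real T * c
          = 4 * y\<^sup>2 * c / real T - 4 * y\<^sup>2 * c * (2 - y) / real T"
        by (simp add: algebra_simps flip: diff_divide_distrib)
      moreover have "(exp 1 - 2) * u * c = exp 1 * (c * u) - 2 * (c * u)"
        by (simp add: algebra_simps)
      ultimately have "2 * (c * u) + 4 * y\<^sup>2 * c / real T
          \<le> exp 1 * (c * u) + 4 * y\<^sup>2 * c * (2 - y) / real T"
        by linarith
      then show ?thesis ..
    qed
  qed
  ultimately have "last_loss T \<le> exp 1 * (c * u) + 4 * y\<^sup>2 * c * (2 - y) / real T"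
    by linarith
  also have "\<dots> = exp 1 * (norm x0)\<^sup>2 / (\<eta> * (2 - y) * real T powr q)
      + 4 * \<beta>\<^sup>2 * \<eta> * (norm x0)\<^sup>2 / real T"
    using y eta_pos by (simp add: c_def u_def) (simp add: y_def power2_eq_square)
  finally show ?thesis
    unfolding q y_def .
qed

lemma last_loss_log_step:
  assumes "T < card I" "2 \<le> T" and \<eta>: "\<eta> = 1 / (\<beta> * ln (real T))"
  shows "last_loss T \<le> 14 * \<beta> * (norm x0)\<^sup>2 * ln (real T) / real T"
proof (cases "T = 2")
  \<comment> \<open>At \<open>T = 2\<close> the general bound exceeds the claim, but the trivial bound suffices.\<close>
  case True
  have "1 / 2 \<le> 14 * ln 2 / (2::real)"
    using ln2_ge_two_thirds by simp
  then have "\<beta> * (norm x0)\<^sup>2 * (1 / 2) \<le> \<beta> * (norm x0)\<^sup>2 * (14 * ln 2 / 2)"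
    using beta_pos by (intro mult_left_mono) auto
  then show ?thesis
    using last_loss_le_half[OF assms(1)] True by (simp add: mult_ac)
next
  case False
  define L where "L = ln (real T)"
  define N where "N = (norm x0)\<^sup>2"
  have T: "3 \<le> real T" using assms(2) False by simp
  \<comment> \<open>Since \<open>exp 1 \<le> 3\<close>, the logarithm is at least 1 from
    \<open>T = 3\<close> on, so \<open>\<eta> * \<beta> \<le> 1\<close>.\<close>
  have "1 = ln (exp (1::real))" by simp
  also have "\<dots> \<le> L"
    unfolding L_def using exp_le T by (subst ln_le_cancel_iff) auto
  finally have L: "1 \<le> L" .
  have \<eta>\<beta>: "\<eta> * \<beta> = 1 / L" using beta_pos by (simp add: \<eta> L_def)
  have L2: "1 \<le> 2 - 1 / L" using L by simp
  have N: "0 \<le> N" by (simp add: N_def)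
  \<comment> \<open>The exponent times \<open>L\<close> is \<open>L - 1 + 1 / (4 * L)\<close>, so
    the power is at least \<open>real T / exp 1\<close>.\<close>
  have "real T / 3 \<le> real T / exp 1"
    using exp_le by (intro divide_left_mono) auto
  also have "\<dots> = exp (L - 1)"
    using T by (simp add: exp_diff L_def)
  also have "\<dots> \<le> exp ((1 - 1 / L * (1 - 1 / L / 4)) * L)"
    using L by (simp add: field_simps)
  also have "\<dots> = real T powr (1 - 1 / L * (1 - 1 / L / 4))"
    using T by (simp add: powr_def L_def mult.commute)
  finally have Tp: "real T / 3 \<le> real T powr (1 - 1 / L * (1 - 1 / L / 4))" .
  have "\<eta> * 1 * (real T / 3) \<le> \<eta> * (2 - 1 / L) * real T powr (1 - 1 / L * (1 - 1 / L / 4))"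
    using eta_pos L2 by (intro mult_mono Tp) auto
  then have "exp 1 * N / (\<eta> * (2 - 1 / L) * real T powr (1 - 1 / L * (1 - 1 / L / 4)))
      \<le> 3 * N / (\<eta> * 1 * (real T / 3))"
    using exp_le T eta_pos N by (intro frac_le mult_right_mono) auto
  also have "\<dots> = 9 * \<beta> * N * L / real T"
    using beta_pos L by (simp add: \<eta> L_def)
  finally have 1: "exp 1 * N / (\<eta> * (2 - 1 / L) * real T powr (1 - 1 / L * (1 - 1 / L / 4)))
      \<le> 9 * \<beta> * N * L / real T" .
  have "4 * \<beta>\<^sup>2 * \<eta> * N = 4 * \<beta> * N * (1 / L)"
    using beta_pos by (simp add: \<eta> L_def power2_eq_square)
  also have "\<dots> \<le> 4 * \<beta> * N * L"
    using L beta_pos N by (intro mult_left_mono) (auto intro: order_trans[of _ 1])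
  finally have "4 * \<beta>\<^sup>2 * \<eta> * N / real T \<le> 4 * \<beta> * N * L / real T"
    by (rule divide_right_mono) simp
  then have "last_loss T \<le> 9 * \<beta> * N * L / real T + 4 * \<beta> * N * L / real T"
    using last_loss_bound[OF assms(1)] assms(2) 1 unfolding \<eta>\<beta> N_def[symmetric] by linarith
  also have "\<dots> \<le> 14 * \<beta> * N * L / real T"
    using N L beta_pos by (simp add: divide_right_mono flip: add_divide_distrib)
  finally show ?thesis unfolding N_def L_def .
qed

text \<open>At \<open>\<eta> * \<beta> = 1\<close> the exponent is 1/4. The constant is 3 + 4, from
  \<open>exp 1 \<le> 3\<close> and from weakening \<open>1 / real T\<close> to the same
  power.\<close>

lemma last_loss_inverse_step:
  assumes "T < card I" "1 \<le> T" and \<eta>: "\<eta> = 1 / \<beta>"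
  shows "last_loss T \<le> 7 * \<beta> * (norm x0)\<^sup>2 / root 4 (real T)"
proof -
  define N where "N = (norm x0)\<^sup>2"
  have T: "1 \<le> real T" using assms(2) by simp
  have root: "root 4 (real T) = real T powr (1 / 4)"
    using T by (simp add: root_powr_inverse)
  have \<eta>\<beta>: "\<eta> * \<beta> = 1" using beta_pos by (simp add: \<eta>)
  have N: "0 \<le> N" by (simp add: N_def)
  have "last_loss T \<le> exp 1 * N / (\<eta> * real T powr (1 / 4)) + 4 * \<beta>\<^sup>2 * \<eta> * N / real T"
    using last_loss_bound[OF assms(1,2)] unfolding \<eta>\<beta> N_def[symmetric] by simp
  also have "\<dots> = exp 1 * (\<beta> * N / real T powr (1 / 4)) + 4 * (\<beta> * N / real T)"
    using beta_pos by (simp add: \<eta> power2_eq_square mult_ac)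
  also have "\<dots> \<le> 3 * (\<beta> * N / real T powr (1 / 4)) + 4 * (\<beta> * N / real T powr (1 / 4))"
    using powr_mono[of "1 / 4" 1 "real T"] T N beta_pos exp_le
    by (intro add_mono mult_right_mono mult_left_mono divide_left_mono) auto
  also have "\<dots> = 7 * \<beta> * N / root 4 (real T)"
    by (simp add: root)
  finally show ?thesis unfolding N_def .
qed

end

section \<open>Least squares losses as quadratics\<close>

definition gram_op :: "nat \<Rightarrow> (nat \<Rightarrow> real^'d) \<Rightarrow> real^'d \<Rightarrow> real^'d" where
  "gram_op m A x = (\<Sum>k<m. (A k \<bullet> x) *\<^sub>R A k)"

lemma gram_mult_vec: "gram m A *v x = gram_op m A x"
proof (rule vec_eq_iff[THEN iffD2], rule allI)
  fix p
  have "(gram m A *v x) $ p = (\<Sum>q\<in>UNIV. \<Sum>k<m. A k $ p * A k $ q * x $ q)"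
    by (simp add: matrix_vector_mult_def gram_def sum_distrib_right)
  also have "\<dots> = (\<Sum>k<m. \<Sum>q\<in>UNIV. A k $ p * A k $ q * x $ q)"
    by (rule sum.swap)
  also have "\<dots> = gram_op m A x $ p"
    by (simp add: gram_op_def inner_vec_def sum_distrib_left mult.commute mult.left_commute)
  finally show "(gram m A *v x) $ p = gram_op m A x $ p" .
qed

lemma gram_op_inner: "gram_op m A x \<bullet> y = (\<Sum>k<m. (A k \<bullet> x) * (A k \<bullet> y))"
  by (simp add: gram_op_def inner_sum_left)

text \<open>For cocoercivity, apply Cauchy-Schwarz for the semi-inner product of the Gram matrix to
  \<open>x\<close> and its image \<open>?z\<close>, bound the form at \<open>?z\<close> by the
  spectral norm, and cancel the squared norm of \<open>?z\<close>.\<close>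

lemma psd_operator_gram_op:
  assumes "spectral_norm (gram m A) \<le> \<beta>" "0 < \<beta>"
  shows "psd_operator (gram_op m A) \<beta>"
proof
  show "gram_op m A (x + y) = gram_op m A x + gram_op m A y" for x y
    by (simp add: gram_op_def inner_add_right scaleR_add_left sum.distrib)
  show "gram_op m A (r *\<^sub>R x) = r *\<^sub>R gram_op m A x" for r x
    by (simp add: gram_op_def scaleR_sum_right)
  show "gram_op m A x \<bullet> y = x \<bullet> gram_op m A y" for x y
    by (simp add: gram_op_inner inner_commute[of x] mult.commute)
  show nonneg: "0 \<le> gram_op m A x \<bullet> x" for x
    by (simp add: gram_op_inner sum_nonneg)
  show "(norm (gram_op m A x))\<^sup>2 \<le> \<beta> * (gram_op m A x \<bullet> x)" for x
  proof -
    let ?z = "gram_op m A x"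
    have bound: "norm (gram_op m A z) \<le> \<beta> * norm z" for z
    proof -
      have "norm (gram_op m A z) \<le> spectral_norm (gram m A) * norm z"
        using onorm[OF matrix_vector_mul_bounded_linear, of "gram m A" z]
        by (simp add: spectral_norm_def gram_mult_vec)
      also have "\<dots> \<le> \<beta> * norm z"
        using assms by (intro mult_right_mono) auto
      finally show ?thesis .
    qed
    have "gram_op m A ?z \<bullet> ?z \<le> norm (gram_op m A ?z) * norm ?z"
      by (rule norm_cauchy_schwarz)
    also have "\<dots> \<le> \<beta> * norm ?z * norm ?z"
      by (intro mult_right_mono bound) simp
    finally have zz: "gram_op m A ?z \<bullet> ?z \<le> \<beta> * (norm ?z)\<^sup>2"
      by (simp add: power2_eq_square mult.assoc)
    have "((norm ?z)\<^sup>2)\<^sup>2 = (?z \<bullet> ?z)\<^sup>2"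
      by (simp add: power2_norm_eq_inner)
    also have "\<dots> \<le> (?z \<bullet> x) * (gram_op m A ?z \<bullet> ?z)"
      using Cauchy_Schwarz_ineq_sum[of "\<lambda>k. A k \<bullet> x" "\<lambda>k. A k \<bullet> ?z" "{..<m}"]
      by (simp add: gram_op_inner power2_eq_square)
    also have "\<dots> \<le> (?z \<bullet> x) * (\<beta> * (norm ?z)\<^sup>2)"
      by (intro mult_left_mono zz nonneg)
    finally have le: "(norm ?z)\<^sup>2 * (norm ?z)\<^sup>2 \<le> \<beta> * (?z \<bullet> x) * (norm ?z)\<^sup>2"
      by (simp add: power2_eq_square mult_ac)
    show ?thesis
    proof (cases "?z = 0")
      case False
      then show ?thesis using mult_right_le_imp_le[OF le] by simp
    qed simp
  qed
  show "0 < \<beta>" by fact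
qed

lemma lsq_loss_sum: "lsq_loss m A b w = (\<Sum>k<m. (A k \<bullet> w - b k)\<^sup>2) / 2"
  by (simp add: lsq_loss_def L2_set_def sum_nonneg)

lemma lsq_loss_eq_0_iff: "lsq_loss m A b w = 0 \<longleftrightarrow> (\<forall>k<m. A k \<bullet> w = b k)"
  by (auto simp: lsq_loss_sum sum_nonneg_eq_0_iff)

text \<open>As \<open>wstar\<close> solves every equation, the residual at \<open>w\<close> is
  \<open>A k \<bullet> (w - wstar)\<close>.\<close>

lemma lsq_loss_gram_op:
  assumes "lsq_loss m A b wstar = 0"
  shows "lsq_loss m A b w = gram_op m A (w - wstar) \<bullet> (w - wstar) / 2"
  using assms unfolding lsq_loss_eq_0_iff unfolding lsq_loss_sum gram_op_inner
  by (intro arg_cong2[where f = "(/)"] sum.cong) (auto simp: inner_diff_right power2_eq_square)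

text \<open>Justifies the definite description in \<open>grad\<close>.\<close>

lemma gderiv_unique:
  assumes "GDERIV f x :> D" "GDERIV f x :> D'"
  shows "D = D'"
proof -
  have "(\<lambda>h. h \<bullet> D) = (\<lambda>h. h \<bullet> D')"
    using assms unfolding gderiv_def by (rule has_derivative_unique)
  then show ?thesis
    by (metis vector_eq_ldot)
qed

lemma grad_lsq_loss:
  assumes "lsq_loss m A b wstar = 0"
  shows "grad (lsq_loss m A b) w = gram_op m A (w - wstar)"
proof -
  have "((\<lambda>w. (\<Sum>k<m. (A k \<bullet> w - b k)\<^sup>2) / 2) has_derivative
      (\<lambda>h. (\<Sum>k<m. 2 * (A k \<bullet> h) * (A k \<bullet> w - b k)) / 2)) (at w)"
    by (auto intro!: derivative_eq_intros)
  moreover have "(\<Sum>k<m. 2 * (A k \<bullet> h) * (A k \<bullet> w - b k)) / 2 = h \<bullet> gram_op m A (w - wstar)" for h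
    using assms unfolding lsq_loss_eq_0_iff inner_commute[of h] gram_op_inner sum_divide_distrib
    by (intro sum.cong) (auto simp: inner_diff_right)
  ultimately have "GDERIV (lsq_loss m A b) w :> gram_op m A (w - wstar)"
    unfolding gderiv_def by (simp add: lsq_loss_sum[abs_def])
  then show ?thesis
    unfolding grad_def by (blast intro: the_equality gderiv_unique)
qed

theorem theoremE4:
  fixes I :: "'i set" and n :: nat
    and m :: "'i \<Rightarrow> nat"
    and A :: "'i \<Rightarrow> nat \<Rightarrow> real^'d" and b :: "'i \<Rightarrow> nat \<Rightarrow> real"
    and f :: "'i \<Rightarrow> real^'d \<Rightarrow> real"
    and \<beta> D :: real and w0 wstar :: "real^'d"
  assumes "finite I" and "card I = n"
    and "\<And>i. i \<in> I \<Longrightarrow> f i = lsq_loss (m i) (A i) (b i)"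
    and "\<beta> > 0"
    and "\<And>i. i \<in> I \<Longrightarrow> spectral_norm (gram (m i) (A i)) \<le> \<beta>"
    and "\<And>i. i \<in> I \<Longrightarrow> f i wstar = 0"
    and "D = norm (w0 - wstar)"
  shows "(\<forall>\<eta>. 0 < \<eta> \<and> \<eta> < 2 / \<beta> \<longrightarrow> (\<forall>T\<in>{2..n-1}.
            expected_last_loss I f w0 \<eta> T
              \<le> exp 1 * D\<^sup>2 / (\<eta> * (2 - \<eta> * \<beta>) * real T powr (1 - \<eta> * \<beta> * (1 - \<eta> * \<beta> / 4)))
                + 4 * \<beta>\<^sup>2 * \<eta> * D\<^sup>2 / real T))
       \<and> (\<forall>T\<in>{2..n-1}.
            expected_last_loss I f w0 (1 / (\<beta> * ln (real T))) T \<le> 14 * \<beta> * D\<^sup>2 * ln (real T) / real T)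
       \<and> (\<forall>T\<in>{2..n-1}.
            expected_last_loss I f w0 (1 / \<beta>) T \<le> 7 * \<beta> * D\<^sup>2 / root 4 (real T))"
proof -
  define P where "P = (\<lambda>i. gram_op (m i) (A i))"
  define x0 where "x0 = w0 - wstar"
  have zero: "lsq_loss (m i) (A i) (b i) wstar = 0" if "i \<in> I" for i
    using assms(3,6) that by simp
  have interp: "without_replacement_descent I P \<beta> \<eta>" if "0 < \<eta>" "\<eta> < 2 / \<beta>" for \<eta>
    using that assms(1,4,5)
    by (intro without_replacement_descent.intro) (auto simp: P_def psd_operator_gram_op field_simps)
  have expected: "expected_last_loss I f w0 \<eta> T = without_replacement_descent.last_loss I P \<eta> x0 T"
    if \<eta>: "0 < \<eta>" "\<eta> < 2 / \<beta>" and T: "T < card I" for \<eta> T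
  proof -
    interpret without_replacement_descent I P \<beta> \<eta> x0 by (rule interp) fact+
    \<comment> \<open>Translation by \<open>wstar\<close> turns the iteration into
      \<open>descent\<close>; up to time \<open>T\<close> every visited entry lies in
      \<open>I\<close>, where \<open>f\<close> is the least squares loss.\<close>
    have sgd: "sgd f \<eta> w0 \<pi> t - wstar = X \<pi> t" if "\<pi> \<in> perms" "t \<le> T" for \<pi> t
      using that(2)
    proof (induction t)
      case 0
      then show ?case by (simp add: x0_def)
    next
      case (Suc t)
      have "\<pi> ! t \<in> I" using Suc.prems T by (intro nth_perm_mem that) auto
      then have "grad (f (\<pi> ! t)) w = P (\<pi> ! t) (w - wstar)" for w
        using assms(3) by (simp add: grad_lsq_loss[OF zero] P_def)
      with Suc show ?case by (simp add: algebra_simps)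
    qed
    have "avg_loss f \<pi> T (sgd f \<eta> w0 \<pi> T) = 1 / real (T + 1) * (\<Sum>t=0..T. \<phi> (\<pi> ! t) (X \<pi> T))"
      if \<pi>: "\<pi> \<in> perms" for \<pi>
    proof -
      have "f (\<pi> ! t) (sgd f \<eta> w0 \<pi> T) = \<phi> (\<pi> ! t) (X \<pi> T)" if "t \<in> {0..T}" for t
      proof -
        have "\<pi> ! t \<in> I" using that T by (intro nth_perm_mem \<pi>) auto
        then show ?thesis
          using assms(3) \<pi> by (simp add: lsq_loss_gram_op[OF zero] sgd \<phi>_def) (simp add: P_def)
      qed
      then show ?thesis by (simp add: avg_loss_def)
    qed
    moreover have "perms \<noteq> {}" using assms(1) by simp
    ultimately show ?thesis
      unfolding expected_last_loss_def last_loss_def E_def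
      by (subst integral_pmf_of_set) (auto intro!: sum.cong arg_cong2[where f = "(/)"])
  qed
  have T_less: "T < card I" "2 \<le> T" if "T \<in> {2..n-1}" for T
    using that assms(2) by auto
  show ?thesis
  proof (intro conjI allI impI ballI)
    fix \<eta> T assume \<eta>: "0 < \<eta> \<and> \<eta> < 2 / \<beta>" and T: "T \<in> {2..n-1}"
    interpret without_replacement_descent I P \<beta> \<eta> x0 by (rule interp) (use \<eta> in auto)
    show "expected_last_loss I f w0 \<eta> T
        \<le> exp 1 * D\<^sup>2 / (\<eta> * (2 - \<eta> * \<beta>) * real T powr (1 - \<eta> * \<beta> * (1 - \<eta> * \<beta> / 4)))
          + 4 * \<beta>\<^sup>2 * \<eta> * D\<^sup>2 / real T"
      using last_loss_bound[of T] T_less[OF T] \<eta> by (simp add: expected assms(7) x0_def)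
  next
    fix T assume T: "T \<in> {2..n-1}"
    define \<eta> where "\<eta> = 1 / (\<beta> * ln (real T))"
    \<comment> \<open>The step size is below \<open>2 / \<beta>\<close> exactly when
      \<open>ln (real T)\<close> exceeds 1/2.\<close>
    have "ln 2 \<le> ln (real T)" using T_less[OF T] by simp
    then have "1 / 2 < ln (real T)" using ln2_ge_two_thirds by simp
    then have \<eta>: "0 < \<eta>" "\<eta> < 2 / \<beta>" using assms(4) by (auto simp: \<eta>_def field_simps)
    interpret without_replacement_descent I P \<beta> \<eta> x0 by (rule interp) (use \<eta> in auto)
    have "expected_last_loss I f w0 \<eta> T \<le> 14 * \<beta> * D\<^sup>2 * ln (real T) / real T"
      using last_loss_log_step[of T] T_less[OF T] \<eta> \<eta>_def
      by (simp only: expected assms(7) x0_def)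
    then show "expected_last_loss I f w0 (1 / (\<beta> * ln (real T))) T
        \<le> 14 * \<beta> * D\<^sup>2 * ln (real T) / real T"
      unfolding \<eta>_def .
  next
    fix T assume T: "T \<in> {2..n-1}"
    have \<eta>: "0 < 1 / \<beta>" "1 / \<beta> < 2 / \<beta>" using assms(4) by (auto simp: field_simps)
    interpret without_replacement_descent I P \<beta> "1 / \<beta>" x0 by (rule interp) (use \<eta> in auto)
    show "expected_last_loss I f w0 (1 / \<beta>) T \<le> 7 * \<beta> * D\<^sup>2 / root 4 (real T)"
      using last_loss_inverse_step[of T] T_less[OF T] \<eta> by (simp add: expected assms(7) x0_def)
  qed
qed

end
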